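(* If $\mathscr{F}\subseteq\mathscr{P}(\omega)$ is a nonempty $\omega$-closed family, then $\boldsymbol{B}_{\omega}^{\mathscr{F}}$ is a combinatorial inverse semigroup.
   Context: $\omega$ is the set of non-negative integers, $\mathscr{P}(\omega)$ its power set. For an integer $n$ and $F\subseteq\omega$ put $n+F=\{n+k\colon k\in F\}\subseteq\mathbb{Z}$ (empty if $F=\varnothing$). A family $\mathscr{F}\subseteq\mathscr{P}(\omega)$ is $\omega$-closed if $F_1\cap(-n+F_2)\in\mathscr{F}$ for all $n\in\omega$ and $F_1,F_2\in\mathscr{F}$. For an $\omega$-closed family $\mathscr{F}$, the set $\boldsymbol{B}_{\omega}\times\mathscr{F}=\omega\times\omega\times\mathscr{F}$ carries the semigroup operation $$(i_1,j_1,F_1)\cdot(i_2,j_2,F_2)=\begin{cases}(i_1-j_1+i_2,\,j_2,\,(j_1-i_2+F_1)\cap F_2), & j_1\leqslant i_2;\\ (i_1,\,j_1-i_2+j_2,\,F_1\cap(i_2-j_1+F_2)), & j_1\geqslant i_2.\end{cases}$$ If $\varnothing\notin\mathscr{F}$, then $\boldsymbol{B}_{\omega}^{\mathscr{F}}=(\boldsymbol{B}_{\omega}\times\mathscr{F},\cdot)$. If $\varnothing\in\mathscr{F}$, then $\boldsymbol{I}=\{(i,j,\varnothing)\colon i,j\in\omega\}$ is an ideal and $\boldsymbol{B}_{\omega}^{\mathscr{F}}$ is the Rees quotient $(\boldsymbol{B}_{\omega}\times\mathscr{F},\cdot)/\boldsymbol{I}$, in which all $(i,j,\varnothing)$ are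 identified to a single zero element $\boldsymbol{0}$. A semigroup $S$ is inverse if for every $x\in S$ there is a unique $x^{-1}\in S$ with $xx^{-1}x=x$ and $x^{-1}xx^{-1}=x^{-1}$. An inverse semigroup is combinatorial if Green's relation $\mathscr{H}$ on it is the equality relation. *)

theory Defs
  imports Main
begin

locale semigroup_on =
  fixes S :: "'a set" and mult :: "'a \<Rightarrow> 'a \<Rightarrow> 'a" (infixl "\<cdot>" 70)
  assumes nonempty: "S \<noteq> {}"
    and closed: "\<lbrakk>x \<in> S; y \<in> S\<rbrakk> \<Longrightarrow> x \<cdot> y \<in> S"
    and assoc: "\<lbrakk>x \<in> S; y \<in> S; z \<in> S\<rbrakk> \<Longrightarrow> (x \<cdot> y) \<cdot> z = x \<cdot> (y \<cdot> z)"

locale inverse_semigroup_on = semigroup_on +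
  assumes unique_inverse:
    "x \<in> S \<Longrightarrow> \<exists>!y. y \<in> S \<and> x \<cdot> y \<cdot> x = x \<and> y \<cdot> x \<cdot> y = y"

text \<open>Principal one-sided ideals \<open>S\<^sup>1a\<close> and \<open>aS\<^sup>1\<close>, where \<open>S\<^sup>1\<close> is \<open>S\<close> with an identity adjoined.\<close>

definition principal_left :: "'a set \<Rightarrow> ('a \<Rightarrow> 'a \<Rightarrow> 'a) \<Rightarrow> 'a \<Rightarrow> 'a set" where
  "principal_left S mult a = insert a {mult s a | s. s \<in> S}"

definition principal_right :: "'a set \<Rightarrow> ('a \<Rightarrow> 'a \<Rightarrow> 'a) \<Rightarrow> 'a \<Rightarrow> 'a set" where
  "principal_right S mult a = insert a {mult a s | s. s \<in> S}"

definition green_L :: "'a set \<Rightarrow> ('a \<Rightarrow> 'a \<Rightarrow> 'a) \<Rightarrow> 'a rel" where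
  "green_L S mult =
    {(a, b). a \<in> S \<and> b \<in> S \<and> principal_left S mult a = principal_left S mult b}"

definition green_R :: "'a set \<Rightarrow> ('a \<Rightarrow> 'a \<Rightarrow> 'a) \<Rightarrow> 'a rel" where
  "green_R S mult =
    {(a, b). a \<in> S \<and> b \<in> S \<and> principal_right S mult a = principal_right S mult b}"

definition green_H :: "'a set \<Rightarrow> ('a \<Rightarrow> 'a \<Rightarrow> 'a) \<Rightarrow> 'a rel" where
  "green_H S mult = green_L S mult \<inter> green_R S mult"

locale combinatorial_inverse_semigroup_on = inverse_semigroup_on +
  assumes green_H_trivial: "green_H S mult = Id_on S"

definition semigroup_ideal :: "'a set \<Rightarrow> ('a \<Rightarrow> 'a \<Rightarrow> 'a) \<Rightarrow> 'a set \<Rightarrow> bool" where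
  "semigroup_ideal S mult I \<longleftrightarrow>
    I \<noteq> {} \<and> I \<subseteq> S \<and> (\<forall>s\<in>S. \<forall>x\<in>I. mult s x \<in> I \<and> mult x s \<in> I)"

definition rees_congruence :: "'a set \<Rightarrow> 'a set \<Rightarrow> 'a rel" where
  "rees_congruence S I = Id_on S \<union> I \<times> I"

definition rees_quotient :: "'a set \<Rightarrow> 'a set \<Rightarrow> 'a set set" where
  "rees_quotient S I = S // rees_congruence S I"

text \<open>For an ideal \<open>I\<close> all products of representatives lie in one class, so the union is that class.\<close>

definition rees_mult ::
    "'a set \<Rightarrow> ('a \<Rightarrow> 'a \<Rightarrow> 'a) \<Rightarrow> 'a set \<Rightarrow> 'a set \<Rightarrow> 'a set \<Rightarrow> 'a set" where
  "rees_mult S mult I X Y = (\<Union>x\<in>X. \<Union>y\<in>Y. rees_congruence S I `` {mult x y})"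

definition translate :: "int \<Rightarrow> nat set \<Rightarrow> int set" where
  "translate n F = {n + int k | k. k \<in> F}"

text \<open>
  Translates are sets of integers; they only ever occur intersected with a subset of
  \<open>\<omega>\<close>, so the intersection is again a set of naturals, written with \<open>int -` _\<close>.
\<close>

definition omega_closed :: "nat set set \<Rightarrow> bool" where
  "omega_closed \<F> \<longleftrightarrow>
    (\<forall>n::nat. \<forall>F1\<in>\<F>. \<forall>F2\<in>\<F>. F1 \<inter> int -` translate (- int n) F2 \<in> \<F>)"

type_synonym elem = "nat \<times> nat \<times> nat set"

definition B_times :: "nat set set \<Rightarrow> elem set" where
  "B_times \<F> = UNIV \<times> UNIV \<times> \<F>"

text \<open>The subtractions on \<open>nat\<close> below never truncate.\<close>

fun B_mult :: "elem \<Rightarrow> elem \<Rightarrow> elem" where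
  "B_mult (i1, j1, F1) (i2, j2, F2) =
    (if j1 \<le> i2
     then (i1 + (i2 - j1), j2, int -` translate (int j1 - int i2) F1 \<inter> F2)
     else (i1, (j1 - i2) + j2, F1 \<inter> int -` translate (int i2 - int j1) F2))"

lemma vimage_translate_0 [simp]: "int -` translate 0 F = F"
  by (auto simp: translate_def)

text \<open>The second clause is also valid in the overlap \<open>j1 = i2\<close>.\<close>

lemma B_mult_ge:
  "i2 \<le> j1 \<Longrightarrow>
    B_mult (i1, j1, F1) (i2, j2, F2) =
      (i1, (j1 - i2) + j2, F1 \<inter> int -` translate (int i2 - int j1) F2)"
  by auto

definition empty_ideal :: "elem set" where
  "empty_ideal = {(i, j, {}) | i j. True}"

lemma B_mult_closed:
  assumes "omega_closed \<F>" "x \<in> B_times \<F>" "y \<in> B_times \<F>"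
  shows "B_mult x y \<in> B_times \<F>"
proof -
  obtain i1 j1 F1 i2 j2 F2 where
    xy: "x = (i1, j1, F1)" "y = (i2, j2, F2)" by (cases x, cases y)
  have F: "F1 \<in> \<F>" "F2 \<in> \<F>" using assms(2,3) by (auto simp: xy B_times_def)
  have "int j1 - int i2 = - int (i2 - j1)" if "j1 \<le> i2" using that by simp
  moreover have "int i2 - int j1 = - int (j1 - i2)" if "\<not> j1 \<le> i2" using that by simp
  ultimately show ?thesis using assms(1) F
    unfolding xy omega_closed_def B_times_def B_mult.simps
    by (simp add: Int_commute del: of_nat_diff)
qed

lemma semigroup_ideal_empty_ideal:
  assumes "{} \<in> \<F>"
  shows "semigroup_ideal (B_times \<F>) B_mult empty_ideal"
  using assms
  by (auto simp: semigroup_ideal_def B_times_def empty_ideal_def translate_def)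

end

theory Submission
  imports Defs
begin

text \<open>
  The triple \<open>(i, j, F)\<close> acts as the partial bijection of \<open>\<omega>\<close> that moves \<open>i + F\<close> onto \<open>j + F\<close>
  by translation. Composing two of these means matching the range \<open>j\<^sub>1 + F\<^sub>1\<close> with the domain
  \<open>i\<^sub>2 + F\<^sub>2\<close>, and this gives the product: lemma \<open>B_mult_max\<close> writes it as one formula,
  with all sets measured from \<open>max j\<^sub>1 i\<^sub>2\<close>. The triple also remembers its pair \<open>(i, j)\<close>, an
  element of the bicyclic monoid, and multiplication is componentwise composition.

  The claims about the product on \<open>\<omega> \<times> \<omega> \<times> \<F>\<close> can be read off from this picture. The triple
  \<open>(j, i, F)\<close> is an inverse of \<open>(i, j, F)\<close>. The idempotents are the triples \<open>(i, i, F)\<close>;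
  they act as partial identities, so they commute, and this makes inverses unique. A right
  multiple of \<open>a\<close> can only raise the first coordinate and shrink the domain \<open>i + F\<close>
  (\<open>B_mult_fst_le\<close>), so \<open>\<R>\<close>-related elements agree in \<open>i\<close> and \<open>F\<close>; dually \<open>\<L>\<close>-related
  elements agree in \<open>j\<close> (and in \<open>F\<close> again). Hence \<open>\<H>\<close> is equality.

  If \<open>{} \<in> \<F>\<close>, the Rees quotient inherits the property from the semigroup of triples by a
  general fact (\<open>rees_quotient_combinatorial\<close>): outside the
  ideal nothing is identified, and an equation between classes whose value is not the zero class
  is an equation between the representatives.
\<close>

section \<open>Inverse semigroups and Green's relations\<close>

context semigroup_on
begin

text \<open>
  Two inverses \<open>y\<close>, \<open>z\<close> of \<open>x\<close> both equal \<open>z x y\<close>: insert \<open>x = x z x\<close> into \<open>y = y x y\<close> and swap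
  the idempotents \<open>y x\<close> and \<open>z x\<close>; symmetrically, insert \<open>x = x y x\<close> into \<open>z = z x z\<close> and swap
  \<open>x y\<close> and \<open>x z\<close>.
\<close>

lemma inverse_semigroupI:
  assumes regular: "\<And>x. x \<in> S \<Longrightarrow> \<exists>y\<in>S. x \<cdot> y \<cdot> x = x \<and> y \<cdot> x \<cdot> y = y"
    and idem_commute: "\<And>e f. \<lbrakk>e \<in> S; f \<in> S; e \<cdot> e = e; f \<cdot> f = f\<rbrakk> \<Longrightarrow> e \<cdot> f = f \<cdot> e"
  shows "inverse_semigroup_on S (\<cdot>)"
proof
  fix x assume x: "x \<in> S"
  have unique: "y = z"
    if y: "y \<in> S" "x \<cdot> y \<cdot> x = x" "y \<cdot> x \<cdot> y = y"
      and z: "z \<in> S" "x \<cdot> z \<cdot> x = x" "z \<cdot> x \<cdot> z = z" for y z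
  proof -
    note [simp] = x y(1) z(1) closed
    have idem: "(y \<cdot> x) \<cdot> (y \<cdot> x) = y \<cdot> x" "(z \<cdot> x) \<cdot> (z \<cdot> x) = z \<cdot> x"
      "(x \<cdot> y) \<cdot> (x \<cdot> y) = x \<cdot> y" "(x \<cdot> z) \<cdot> (x \<cdot> z) = x \<cdot> z"
      using y z by (simp_all flip: assoc)
    have "y = y \<cdot> (x \<cdot> z \<cdot> x) \<cdot> y" using y z by simp
    also have "\<dots> = (y \<cdot> x) \<cdot> (z \<cdot> x) \<cdot> y" by (simp add: assoc)
    also have "\<dots> = (z \<cdot> x) \<cdot> (y \<cdot> x) \<cdot> y"
      using idem_commute[of "y \<cdot> x" "z \<cdot> x"] idem by simp
    also have "\<dots> = z \<cdot> x \<cdot> (y \<cdot> x \<cdot> y)" by (simp add: assoc)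
    finally have 1: "y = z \<cdot> x \<cdot> y" using y by simp
    have "z = z \<cdot> (x \<cdot> y \<cdot> x) \<cdot> z" using y z by simp
    also have "\<dots> = z \<cdot> ((x \<cdot> y) \<cdot> (x \<cdot> z))" by (simp add: assoc)
    also have "\<dots> = z \<cdot> ((x \<cdot> z) \<cdot> (x \<cdot> y))"
      using idem_commute[of "x \<cdot> y" "x \<cdot> z"] idem by simp
    also have "\<dots> = z \<cdot> x \<cdot> z \<cdot> x \<cdot> y" by (simp add: assoc)
    finally have "z = z \<cdot> x \<cdot> y" using z by simp
    with 1 show "y = z" by simp
  qed
  show "\<exists>!y. y \<in> S \<and> x \<cdot> y \<cdot> x = x \<and> y \<cdot> x \<cdot> y = y"
    using regular[OF x] unique by blast
qed

lemma principal_left_mono: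
  assumes "b \<in> S" "a \<in> principal_left S (\<cdot>) b"
  shows "principal_left S (\<cdot>) a \<subseteq> principal_left S (\<cdot>) b"
proof
  fix c assume "c \<in> principal_left S (\<cdot>) a"
  then consider "c = a" | s where "s \<in> S" "c = s \<cdot> a" by (auto simp: principal_left_def)
  then show "c \<in> principal_left S (\<cdot>) b"
  proof cases
    case 1 with assms show ?thesis by simp
  next
    case 2
    from assms consider "a = b" | t where "t \<in> S" "a = t \<cdot> b" by (auto simp: principal_left_def)
    then show ?thesis
    proof cases
      case 1 with 2 show ?thesis by (auto simp: principal_left_def)
    next
      case (2 t)
      with \<open>s \<in> S\<close> \<open>c = s \<cdot> a\<close> assms(1) have "c = (s \<cdot> t) \<cdot> b" by (simp add: assoc)
      with 2 \<open>s \<in> S\<close> show ?thesis by (auto simp: principal_left_def intro: closed)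
    qed
  qed
qed

lemma principal_right_mono:
  assumes "b \<in> S" "a \<in> principal_right S (\<cdot>) b"
  shows "principal_right S (\<cdot>) a \<subseteq> principal_right S (\<cdot>) b"
proof
  fix c assume "c \<in> principal_right S (\<cdot>) a"
  then consider "c = a" | s where "s \<in> S" "c = a \<cdot> s" by (auto simp: principal_right_def)
  then show "c \<in> principal_right S (\<cdot>) b"
  proof cases
    case 1 with assms show ?thesis by simp
  next
    case 2
    from assms consider "a = b" | t where "t \<in> S" "a = b \<cdot> t" by (auto simp: principal_right_def)
    then show ?thesis
    proof cases
      case 1 with 2 show ?thesis by (auto simp: principal_right_def)
    next
      case (2 t)
      with \<open>s \<in> S\<close> \<open>c = a \<cdot> s\<close> assms(1) have "c = b \<cdot> (t \<cdot> s)" by (simp add: assoc)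
      with 2 \<open>s \<in> S\<close> show ?thesis by (auto simp: principal_right_def intro: closed)
    qed
  qed
qed

lemma green_H_iff:
  "(a, b) \<in> green_H S (\<cdot>) \<longleftrightarrow> a \<in> S \<and> b \<in> S \<and>
    a \<in> principal_left S (\<cdot>) b \<and> b \<in> principal_left S (\<cdot>) a \<and>
    a \<in> principal_right S (\<cdot>) b \<and> b \<in> principal_right S (\<cdot>) a"
  (is "?L \<longleftrightarrow> ?R")
proof
  have "c \<in> principal_left S (\<cdot>) c" "c \<in> principal_right S (\<cdot>) c" for c
    by (auto simp: principal_left_def principal_right_def)
  then show "?L \<Longrightarrow> ?R"
    unfolding green_H_def green_L_def green_R_def by blast
  show "?R \<Longrightarrow> ?L"
    unfolding green_H_def green_L_def green_R_def
    using principal_left_mono principal_right_mono by (simp add: subset_antisym)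
qed

lemma green_H_trivialI:
  assumes "\<And>a b. (a, b) \<in> green_H S (\<cdot>) \<Longrightarrow> a = b"
  shows "green_H S (\<cdot>) = Id_on S"
proof -
  have "(a, a) \<in> green_H S (\<cdot>)" if "a \<in> S" for a
    using that by (simp add: green_H_def green_L_def green_R_def)
  moreover have "a \<in> S" if "(a, b) \<in> green_H S (\<cdot>)" for a b
    using that by (simp add: green_H_iff)
  ultimately show ?thesis using assms by fastforce
qed

end

section \<open>Rees quotients\<close>

definition rees_class :: "'a set \<Rightarrow> 'a \<Rightarrow> 'a set" where
  "rees_class I x = (if x \<in> I then I else {x})"

lemma rees_class_in [simp]: "x \<in> I \<Longrightarrow> rees_class I x = I"
  by (simp add: rees_class_def)

lemma rees_class_eq_iff:
  "rees_class I x = rees_class I y \<longleftrightarrow> x = y \<or> x \<in> I \<and> y \<in> I"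
  by (auto simp: rees_class_def)

lemma rees_congruence_Image:
  "I \<subseteq> S \<Longrightarrow> x \<in> S \<Longrightarrow> rees_congruence S I `` {x} = rees_class I x"
  by (auto simp: rees_congruence_def rees_class_def)

lemma rees_quotient_eq:
  "I \<subseteq> S \<Longrightarrow> rees_quotient S I = rees_class I ` S"
  by (auto simp: rees_quotient_def quotient_def rees_congruence_Image)

context semigroup_on
begin

lemma rees_mult_class:
  assumes I: "semigroup_ideal S (\<cdot>) I" and x: "x \<in> S" and y: "y \<in> S"
  shows "rees_mult S (\<cdot>) I (rees_class I x) (rees_class I y) = rees_class I (x \<cdot> y)"
proof -
  have IS: "I \<subseteq> S" using I by (simp add: semigroup_ideal_def)
  have mem: "u \<in> rees_class I u" for u by (simp add: rees_class_def)
  have const: "rees_congruence S I `` {u \<cdot> v} = rees_class I (x \<cdot> y)"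
    if "u \<in> rees_class I x" "v \<in> rees_class I y" for u v
  proof -
    have "u \<in> S" "v \<in> S" using that x y IS by (auto simp: rees_class_def split: if_splits)
    moreover have "u = x \<or> u \<in> I \<and> x \<in> I" "v = y \<or> v \<in> I \<and> y \<in> I"
      using that by (auto simp: rees_class_def split: if_splits)
    ultimately have "u \<cdot> v = x \<cdot> y \<or> u \<cdot> v \<in> I \<and> x \<cdot> y \<in> I"
      using I x y unfolding semigroup_ideal_def by blast
    then show ?thesis
      using \<open>u \<in> S\<close> \<open>v \<in> S\<close> IS by (simp add: rees_congruence_Image closed rees_class_eq_iff)
  qed
  show ?thesis
    unfolding rees_mult_def using const mem[of x] mem[of y] by fastforce
qed

lemma rees_quotient_semigroup:
  assumes I: "semigroup_ideal S (\<cdot>) I"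
  shows "semigroup_on (rees_quotient S I) (rees_mult S (\<cdot>) I)"
proof -
  have Q: "rees_quotient S I = rees_class I ` S"
    using I by (simp add: semigroup_ideal_def rees_quotient_eq)
  show ?thesis
    by unfold_locales
      (auto simp: Q nonempty rees_mult_class[OF I] closed assoc)
qed

end

text \<open>
  If \<open>x \<notin> I\<close> then a factorisation of the class of \<open>x\<close> lifts to a factorisation of \<open>x\<close> itself, and
  none of its factors lies in \<open>I\<close>. So inverses of a nonzero class, and \<open>\<H>\<close>-relations between
  nonzero classes, come from \<open>S\<close>. The zero class absorbs products, so it is its own only
  inverse and is \<open>\<H>\<close>-related only to itself.
\<close>

theorem rees_quotient_combinatorial:
  assumes "combinatorial_inverse_semigroup_on S mult"
    and I: "semigroup_ideal S mult I"
  shows "combinatorial_inverse_semigroup_on (rees_quotient S I) (rees_mult S mult I)"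
proof -
  interpret combinatorial_inverse_semigroup_on S mult by fact
  let ?Q = "rees_quotient S I" and ?m = "rees_mult S mult I" and ?c = "rees_class I"
  have Q: "?Q = ?c ` S"
    using I by (simp add: semigroup_ideal_def rees_quotient_eq)
  interpret Q: semigroup_on ?Q ?m by (rule rees_quotient_semigroup[OF I])
  have IR: "mult x s \<in> I" "mult s x \<in> I" if "x \<in> I" "s \<in> S" for x s
    using I that by (auto simp: semigroup_ideal_def)
  note m = rees_mult_class[OF I]
  have inverse_iff:
    "?m (?m (?c x) (?c y)) (?c x) = ?c x \<and> ?m (?m (?c y) (?c x)) (?c y) = ?c y \<longleftrightarrow>
     (x \<in> I \<and> y \<in> I \<or> mult (mult x y) x = x \<and> mult (mult y x) y = y)"
    if "x \<in> S" "y \<in> S" for x y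
    using that IR closed by (simp add: m rees_class_eq_iff) metis
  have inv: "\<exists>!Y. Y \<in> ?Q \<and> ?m (?m X Y) X = X \<and> ?m (?m Y X) Y = Y" if X: "X \<in> ?Q" for X
  proof -
    obtain x where x: "x \<in> S" "X = ?c x" using X Q by auto
    obtain y where y: "y \<in> S" "mult (mult x y) x = x" "mult (mult y x) y = y"
      using unique_inverse[OF x(1)] by blast
    have "Z = ?c y" if Z: "Z \<in> ?Q" "?m (?m X Z) X = X" "?m (?m Z X) Z = Z" for Z
    proof -
      obtain z where z: "z \<in> S" "Z = ?c z" using Z Q by auto
      from inverse_iff[OF x(1) z(1)] Z z x
      consider "x \<in> I" "z \<in> I" | "mult (mult x z) x = x" "mult (mult z x) z = z" by auto
      then show ?thesis
      proof cases
        case 1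
        then have "y \<in> I" using y x IR closed by metis
        with 1 z show ?thesis by simp
      next
        case 2
        then have "z = y" using unique_inverse[OF x(1)] y z(1) by blast
        with z show ?thesis by simp
      qed
    qed
    moreover have "?c y \<in> ?Q" "?m (?m X (?c y)) X = X" "?m (?m (?c y) X) (?c y) = ?c y"
      using inverse_iff[OF x(1) y(1)] x y Q by auto
    ultimately show ?thesis by blast
  qed
  have left: "a \<in> principal_left S mult b \<or> a \<in> I \<and> b \<in> I"
    if "a \<in> S" "b \<in> S" "?c a \<in> principal_left ?Q ?m (?c b)" "a \<in> I \<Longrightarrow> b \<in> I" for a b
    using that by (auto simp: principal_left_def Q m rees_class_eq_iff)
  have right: "a \<in> principal_right S mult b \<or> a \<in> I \<and> b \<in> I"
    if "a \<in> S" "b \<in> S" "?c a \<in> principal_right ?Q ?m (?c b)" "a \<in> I \<Longrightarrow> b \<in> I" for a b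
    using that by (auto simp: principal_right_def Q m rees_class_eq_iff)
  have absorb: "a \<in> I"
    if "a \<in> S" "b \<in> I" "b \<in> S" "?c a \<in> principal_left ?Q ?m (?c b)" for a b
    using that IR by (auto simp: principal_left_def Q m rees_class_eq_iff
        simp del: rees_class_in)
  have H: "A = B" if AB: "(A, B) \<in> green_H ?Q ?m" for A B
  proof -
    have "A \<in> ?Q" "B \<in> ?Q" using AB by (simp_all add: Q.green_H_iff)
    then obtain a b where ab: "a \<in> S" "A = ?c a" "b \<in> S" "B = ?c b" using Q by auto
    have pr: "?c a \<in> principal_left ?Q ?m (?c b)" "?c b \<in> principal_left ?Q ?m (?c a)"
      "?c a \<in> principal_right ?Q ?m (?c b)" "?c b \<in> principal_right ?Q ?m (?c a)"
      using AB ab by (auto simp: Q.green_H_iff)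
    have iff: "a \<in> I \<longleftrightarrow> b \<in> I" using absorb ab pr by blast
    show ?thesis
    proof (cases "a \<in> I")
      case True with iff ab show ?thesis by simp
    next
      case False
      with iff left right ab pr have "(a, b) \<in> green_H S mult"
        unfolding green_H_iff by blast
      with green_H_trivial ab show ?thesis by auto
    qed
  qed
  show ?thesis
    by unfold_locales (use inv Q.green_H_trivialI H in \<open>auto\<close>)
qed

section \<open>The semigroup of triples\<close>

lemma B_mult_max:
  "B_mult (i1, j1, F1) (i2, j2, F2) =
    (let m = max j1 i2 in
      (i1 + (m - j1), j2 + (m - i2), {k. k + (m - j1) \<in> F1 \<and> k + (m - i2) \<in> F2}))"
proof -
  have shift: "int -` translate (int p - int q) F = {k. k + (q - p) \<in> F}" if "p \<le> q"
    for p q :: nat and F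
  proof (intro set_eqI iffI)
    fix k assume "k \<in> int -` translate (int p - int q) F"
    then obtain l where "l \<in> F" "int k = int p - int q + int l" by (auto simp: translate_def)
    then have "k + (q - p) = l" using that by linarith
    with \<open>l \<in> F\<close> show "k \<in> {k. k + (q - p) \<in> F}" by simp
  next
    fix k assume "k \<in> {k. k + (q - p) \<in> F}"
    moreover have "int k = int p - int q + int (k + (q - p))" using that by linarith
    ultimately show "k \<in> int -` translate (int p - int q) F"
      unfolding translate_def by blast
  qed
  show ?thesis by (auto simp: Let_def shift max_def simp del: vimage_eq)
qed

lemma B_mult_assoc: "B_mult (B_mult x y) z = B_mult x (B_mult y z)"
proof -
  obtain i1 j1 F1 i2 j2 F2 i3 j3 F3 where
    xyz: "x = (i1, j1, F1)" "y = (i2, j2, F2)" "z = (i3, j3, F3)"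
    by (cases x, cases y, cases z)
  (* Both triple products measure all sets from one common point. In the frame of y it lies at the
     least offset that reaches j1 on the side of i2 and i3 on the side of j2. *)
  define d where "d = max (j1 - i2) (i3 - j2)"
  have "B_mult (B_mult x y) z =
    (i1 + (i2 + d - j1), j3 + (j2 + d - i3),
      {k. k + (i2 + d - j1) \<in> F1 \<and> k + d \<in> F2 \<and> k + (j2 + d - i3) \<in> F3})"
    unfolding xyz B_mult_max Let_def d_def
    by (auto simp: max_def algebra_simps)
  moreover have "B_mult x (B_mult y z) =
    (i1 + (i2 + d - j1), j3 + (j2 + d - i3),
      {k. k + (i2 + d - j1) \<in> F1 \<and> k + d \<in> F2 \<and> k + (j2 + d - i3) \<in> F3})"
    unfolding xyz B_mult_max Let_def d_def
    by (auto simp: max_def algebra_simps)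
  ultimately show ?thesis by simp
qed

lemma semigroup_on_B_times:
  assumes "\<F> \<noteq> {}" "omega_closed \<F>"
  shows "semigroup_on (B_times \<F>) B_mult"
proof
  show "B_times \<F> \<noteq> {}" using assms by (auto simp: B_times_def)
qed (use assms in \<open>auto intro: B_mult_closed simp: B_mult_assoc\<close>)

lemma B_mult_inverse:
  "B_mult (B_mult (i, j, F) (j, i, F)) (i, j, F) = (i, j, F)"
  by (simp add: B_mult_max Let_def del: B_mult.simps)

lemma B_mult_idem: "B_mult (i, j, F) (i, j, F) = (i, j, F) \<Longrightarrow> i = j"
  unfolding B_mult_max Let_def by auto

lemma B_mult_idem_commute:
  "B_mult (i, i, F) (j, j, G) = B_mult (j, j, G) (i, i, F)"
  unfolding B_mult_max Let_def by (auto simp: max.commute)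

text \<open>
  The condition on sets says \<open>i' + F' \<subseteq> i + F\<close>: the domain of a composite lies in the domain of
  the map applied first.
\<close>

lemma B_mult_fst_le:
  assumes "B_mult (i, j, F) s = (i', j', F')"
  shows "i \<le> i' \<and> (\<forall>k\<in>F'. k + (i' - i) \<in> F)"
  using assms by (cases s) (auto simp: B_mult_max Let_def simp del: B_mult.simps)

lemma B_mult_snd_le: "B_mult s (i, j, F) = (i', j', F') \<Longrightarrow> j \<le> j'"
  by (cases s) (auto simp: B_mult_max Let_def simp del: B_mult.simps)

theorem combinatorial_B_times:
  assumes "\<F> \<noteq> {}" "omega_closed \<F>"
  shows "combinatorial_inverse_semigroup_on (B_times \<F>) B_mult"
proof -
  interpret semigroup_on "B_times \<F>" B_mult
    by (rule semigroup_on_B_times[OF assms])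
  interpret inverse_semigroup_on "B_times \<F>" B_mult
  proof (rule inverse_semigroupI)
    fix x assume "x \<in> B_times \<F>"
    then obtain i j F where "x = (i, j, F)" "F \<in> \<F>" by (auto simp: B_times_def)
    then have "(j, i, F) \<in> B_times \<F>" "B_mult (B_mult x (j, i, F)) x = x"
      "B_mult (B_mult (j, i, F) x) (j, i, F) = (j, i, F)"
      by (auto simp: B_times_def B_mult_inverse simp del: B_mult.simps)
    then show "\<exists>y\<in>B_times \<F>. B_mult (B_mult x y) x = x \<and> B_mult (B_mult y x) y = y"
      by blast
  next
    fix e f assume "B_mult e e = e" "B_mult f f = f"
    then show "B_mult e f = B_mult f e"
      by (metis B_mult_idem B_mult_idem_commute prod_cases3)
  qed
  have "a = b" if ab: "(a, b) \<in> green_H (B_times \<F>) B_mult" for a b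
  proof -
    obtain i j F i' j' F' where eq: "a = (i, j, F)" "b = (i', j', F')"
      by (cases a, cases b)
    have fst: "p \<le> p' \<and> (\<forall>k\<in>G'. k + (p' - p) \<in> G)"
      if "(p', q', G') \<in> principal_right (B_times \<F>) B_mult (p, q, G)" for p q G p' q' G'
    proof -
      from that consider "(p', q', G') = (p, q, G)" | s where "B_mult (p, q, G) s = (p', q', G')"
        unfolding principal_right_def by (auto simp del: B_mult.simps)
      then show ?thesis by cases (simp, rule B_mult_fst_le)
    qed
    have snd: "q \<le> q'"
      if "(p', q', G') \<in> principal_left (B_times \<F>) B_mult (p, q, G)" for p q G p' q' G'
      using that B_mult_snd_le[of _ p q G p' q' G']
      by (auto simp: principal_left_def simp del: B_mult.simps)
    have "i = i'" "j = j'"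
      using ab fst snd unfolding eq green_H_iff by (meson le_antisym)+
    moreover have "F = F'"
      using ab fst[of i j F i' j' F'] fst[of i' j' F' i j F] \<open>i = i'\<close>
      unfolding eq green_H_iff by auto
    ultimately show ?thesis by (simp add: eq)
  qed
  then show ?thesis
    by unfold_locales (rule green_H_trivialI)
qed

theorem mainTheorem2:
  fixes \<F> :: "nat set set"
  assumes "\<F> \<noteq> {}" and "omega_closed \<F>"
  shows "({} \<notin> \<F> \<longrightarrow> combinatorial_inverse_semigroup_on (B_times \<F>) B_mult) \<and>
    ({} \<in> \<F> \<longrightarrow>
      combinatorial_inverse_semigroup_on
        (rees_quotient (B_times \<F>) empty_ideal)
        (rees_mult (B_times \<F>) B_mult empty_ideal))"
  using combinatorial_B_times[OF assms] rees_quotient_combinatorial semigroup_ideal_empty_ideal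
  by blast

end
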